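(* Every tree of finite height is pseudofinite, both when viewed as a structure in the language $\{\operatorname{Pred}\}$ and when viewed as a structure in the language $\{\le\}$. That is, if $\mathcal M$ is a tree of finite height and $\varphi$ is a first-order sentence in the respective language with $\mathcal M\vDash\varphi$, then $\varphi$ has a finite model.
   Context: A tree (in language $\{\le\}$) is a partial order with a least element (the root) in which the set of elements below any given element is a finite chain; it has finite height if there is $h<\omega$ such that every element has at most $h$ elements strictly below it. In the language $\{\operatorname{Pred}\}$, $\operatorname{Pred}(x,y)$ holds iff $x$ is the immediate predecessor of $y$ in the tree. *)

theory Defs
  imports Main
begin

section \<open>First-order logic with equality over binary relation symbols\<close>

text \<open>The type parameter \<open>'r\<close> is the set of (binary) relation symbols of the language;
  there are no function or constant symbols.  Variables are natural numbers.\<close>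

datatype 'r fm =
    Eq nat nat
  | Rel 'r nat nat
  | Neg "'r fm"
  | Conj "'r fm" "'r fm"
  | Exi nat "'r fm"

primrec free_vars :: "'r fm \<Rightarrow> nat set" where
  "free_vars (Eq i j) = {i, j}"
| "free_vars (Rel R i j) = {i, j}"
| "free_vars (Neg \<phi>) = free_vars \<phi>"
| "free_vars (Conj \<phi> \<psi>) = free_vars \<phi> \<union> free_vars \<psi>"
| "free_vars (Exi i \<phi>) = free_vars \<phi> - {i}"

definition sentence :: "'r fm \<Rightarrow> bool" where
  "sentence \<phi> \<longleftrightarrow> free_vars \<phi> = {}"

record ('r, 'a) struc =
  universe :: "'a set"
  interp :: "'r \<Rightarrow> 'a rel"

definition is_struc :: "('r, 'a) struc \<Rightarrow> bool" where
  "is_struc M \<longleftrightarrow>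
     universe M \<noteq> {} \<and> (\<forall>R. interp M R \<subseteq> universe M \<times> universe M)"

primrec sat :: "('r, 'a) struc \<Rightarrow> (nat \<Rightarrow> 'a) \<Rightarrow> 'r fm \<Rightarrow> bool" where
  "sat M e (Eq i j) \<longleftrightarrow> e i = e j"
| "sat M e (Rel R i j) \<longleftrightarrow> (e i, e j) \<in> interp M R"
| "sat M e (Neg \<phi>) \<longleftrightarrow> \<not> sat M e \<phi>"
| "sat M e (Conj \<phi> \<psi>) \<longleftrightarrow> sat M e \<phi> \<and> sat M e \<psi>"
| "sat M e (Exi i \<phi>) \<longleftrightarrow> (\<exists>a\<in>universe M. sat M (e(i := a)) \<phi>)"

text \<open>For a sentence the truth value does not depend on the assignment.  The quantification is
  not vacuous, as structures have nonempty universes.\<close>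

definition models :: "('r, 'a) struc \<Rightarrow> 'r fm \<Rightarrow> bool" where
  "models M \<phi> \<longleftrightarrow> (\<forall>e. range e \<subseteq> universe M \<longrightarrow> sat M e \<phi>)"

text \<open>Every finite structure is isomorphic to one whose universe is a finite set of natural
  numbers, so fixing the element type \<open>nat\<close> below loses no finite models.\<close>

definition has_finite_model :: "'r fm \<Rightarrow> bool" where
  "has_finite_model \<phi> \<longleftrightarrow>
     (\<exists>N :: ('r, nat) struc. is_struc N \<and> finite (universe N) \<and> models N \<phi>)"

definition pseudofinite :: "('r, 'a) struc \<Rightarrow> bool" where
  "pseudofinite M \<longleftrightarrow>
     (\<forall>\<phi>. sentence \<phi> \<longrightarrow> models M \<phi> \<longrightarrow> has_finite_model \<phi>)"

section \<open>Trees\<close>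

definition is_tree :: "'a set \<Rightarrow> 'a rel \<Rightarrow> bool" where
  "is_tree T r \<longleftrightarrow>
     partial_order_on T r \<and>
     (\<exists>x0\<in>T. \<forall>x\<in>T. (x0, x) \<in> r) \<and>
     (\<forall>x\<in>T. finite (underS r x) \<and> total_on (underS r x) r)"

definition finite_height :: "'a set \<Rightarrow> 'a rel \<Rightarrow> bool" where
  "finite_height T r \<longleftrightarrow>
     (\<exists>h::nat. \<forall>x\<in>T. finite (underS r x) \<and> card (underS r x) \<le> h)"

definition immediate_pred :: "'a rel \<Rightarrow> 'a \<Rightarrow> 'a \<Rightarrow> bool" where
  "immediate_pred r x y \<longleftrightarrow>
     x \<in> underS r y \<and> \<not> (\<exists>z. x \<in> underS r z \<and> z \<in> underS r y)"

datatype lang_le = Leq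
datatype lang_pred = Pred

definition le_struc :: "'a set \<Rightarrow> 'a rel \<Rightarrow> (lang_le, 'a) struc" where
  "le_struc T r = \<lparr>universe = T, interp = (\<lambda>Leq \<Rightarrow> r)\<rparr>"

definition pred_struc :: "'a set \<Rightarrow> 'a rel \<Rightarrow> (lang_pred, 'a) struc" where
  "pred_struc T r = \<lparr>universe = T, interp = (\<lambda>Pred \<Rightarrow> {(x, y). immediate_pred r x y})\<rparr>"

end

theory Submission
  imports Defs "HOL-Library.FuncSet"
begin

text \<open>
  Only boundedly many elements can be inspected by a formula of bounded quantifier rank.  Colour the
  nodes, from the leaves down to the root, so that the colour of a node records how many children
  of each colour it has, counted up to a threshold \<open>K\<close>; finitely many colours suffice since the
  height is finite.  Keeping at every node only as many children of each colour as the threshold can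
  distinguish leaves a finite subtree.  Duplicator wins the Ehrenfeucht--Fraisse game between tree
  and subtree by maintaining a colour-preserving isomorphism between finite downward closed sets.
  A move adds the path from the root to the chosen node, one child at a time, so that \<open>K\<close> need only
  exceed the number of rounds times the height.
\<close>

section \<open>Formulas\<close>

primrec qrank :: "'r fm \<Rightarrow> nat" where
  "qrank (Eq i j) = 0"
| "qrank (Rel R i j) = 0"
| "qrank (Neg \<phi>) = qrank \<phi>"
| "qrank (Conj \<phi> \<psi>) = max (qrank \<phi>) (qrank \<psi>)"
| "qrank (Exi i \<phi>) = Suc (qrank \<phi>)"

lemma sat_cong_free_vars:
  "(\<And>i. i \<in> free_vars \<phi> \<Longrightarrow> e i = e' i) \<Longrightarrow> sat M e \<phi> \<longleftrightarrow> sat M e' \<phi>"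
proof (induction \<phi> arbitrary: e e')
  case (Exi i \<phi>)
  have "sat M (e(i := a)) \<phi> \<longleftrightarrow> sat M (e'(i := a)) \<phi>" for a
    by (rule Exi.IH) (use Exi.prems in auto)
  then show ?case by simp
next
  case (Conj \<phi> \<psi>)
  have "sat M e \<phi> \<longleftrightarrow> sat M e' \<phi>" by (rule Conj.IH(1)) (use Conj.prems in auto)
  moreover have "sat M e \<psi> \<longleftrightarrow> sat M e' \<psi>" by (rule Conj.IH(2)) (use Conj.prems in auto)
  ultimately show ?case by simp
next
  case (Neg \<phi>)
  have "sat M e \<phi> \<longleftrightarrow> sat M e' \<phi>" by (rule Neg.IH) (use Neg.prems in auto)
  then show ?case by simp
qed simp_all

lemma models_sentence_iff:
  assumes "sentence \<phi>" "range e \<subseteq> universe M"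
  shows "models M \<phi> \<longleftrightarrow> sat M e \<phi>"
proof -
  have "sat M e' \<phi> \<longleftrightarrow> sat M e \<phi>" for e'
    by (rule sat_cong_free_vars) (use assms(1) in \<open>simp add: sentence_def\<close>)
  then show ?thesis using assms(2) by (auto simp: models_def)
qed

section \<open>Copies of finite structures on the natural numbers\<close>

definition image_struc :: "('a \<Rightarrow> 'b) \<Rightarrow> ('r, 'a) struc \<Rightarrow> ('r, 'b) struc" where
  "image_struc g M =
     \<lparr>universe = g ` universe M, interp = (\<lambda>R. map_prod g g ` interp M R)\<rparr>"

lemma sat_image_struc:
  assumes "is_struc M" and inj: "inj_on g (universe M)"
  shows "range e \<subseteq> universe M \<Longrightarrow> sat (image_struc g M) (g \<circ> e) \<phi> \<longleftrightarrow> sat M e \<phi>"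
proof (induction \<phi> arbitrary: e)
  case (Eq i j)
  then have "e i \<in> universe M" "e j \<in> universe M" by auto
  then show ?case using inj by (simp add: inj_on_eq_iff)
next
  case (Rel R i j)
  have "interp M R \<subseteq> universe M \<times> universe M" using assms(1) by (simp add: is_struc_def)
  moreover have "e i \<in> universe M" "e j \<in> universe M" using Rel by auto
  ultimately have "(g (e i), g (e j)) \<in> map_prod g g ` interp M R \<longleftrightarrow> (e i, e j) \<in> interp M R"
    using inj_on_image_mem_iff[OF map_prod_inj_on[OF inj inj], of "(e i, e j)" "interp M R"] by simp
  then show ?case by (simp add: image_struc_def)
next
  case (Exi i \<phi>)
  have "sat (image_struc g M) ((g \<circ> e)(i := g a)) \<phi> \<longleftrightarrow> sat M (e(i := a)) \<phi>"
    if "a \<in> universe M" for a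
  proof -
    have "(g \<circ> e)(i := g a) = g \<circ> e(i := a)" by auto
    moreover have "range (e(i := a)) \<subseteq> universe M" using Exi.prems that by auto
    ultimately show ?thesis using Exi.IH by presburger
  qed
  moreover have "universe (image_struc g M) = g ` universe M" by (simp add: image_struc_def)
  ultimately show ?case by (simp del: fun_upd_apply o_apply)
qed simp_all

text \<open>The notion of finite model asks for a universe inside \<open>nat\<close>; a finite
  universe injects there, and truth is carried along the resulting isomorphism.\<close>

lemma has_finite_modelI:
  assumes "is_struc M" "finite (universe M)" "sentence \<phi>" "models M \<phi>"
  shows "has_finite_model \<phi>"
proof -
  obtain g :: "'b \<Rightarrow> nat" where g: "inj_on g (universe M)"
    using assms(2) finite_imp_inj_to_nat_seg by blast
  obtain u where u: "u \<in> universe M" using assms(1) by (auto simp: is_struc_def)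
  let ?N = "image_struc g M"
  have "sat ?N (g \<circ> (\<lambda>_. u)) \<phi>"
    using sat_image_struc[OF assms(1) g, of "\<lambda>_. u"] assms(4) u by (auto simp: models_def)
  then have "models ?N \<phi>"
    using models_sentence_iff[OF assms(3), of "g \<circ> (\<lambda>_. u)" ?N] u by (auto simp: image_struc_def)
  moreover have "is_struc ?N"
    using assms(1) by (fastforce simp: is_struc_def image_struc_def)
  moreover have "finite (universe ?N)"
    using assms(2) by (simp add: image_struc_def)
  ultimately show ?thesis unfolding has_finite_model_def by blast
qed

section \<open>Truncated cardinalities\<close>

text \<open>The infinite case is set apart because \<open>card\<close> returns 0 on infinite sets,
  whereas these must reach the threshold.\<close>

definition tcard :: "nat \<Rightarrow> 'a set \<Rightarrow> nat" where
  "tcard K S = (if finite S then min K (card S) else K)"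

lemma tcard_le: "tcard K S \<le> K"
  by (simp add: tcard_def)

lemma tcard_mono: "S \<subseteq> S' \<Longrightarrow> tcard K S \<le> tcard K S'"
  by (auto simp: tcard_def finite_subset card_mono intro: min.coboundedI2)

lemma tcard_finite_subset: "\<exists>S0\<subseteq>S. finite S0 \<and> tcard K S0 = tcard K S"
proof (cases "finite S")
  case False
  then obtain S0 where "finite S0" "card S0 = K" "S0 \<subseteq> S"
    using infinite_arbitrarily_large by blast
  then show ?thesis using False by (auto simp: tcard_def)
qed auto

text \<open>This supplies a fresh reply in the game: \<open>X\<close> and \<open>Y\<close> hold the
  elements already used. If \<open>Y\<close> covered \<open>S'\<close>, the count of
  \<open>S'\<close> would be at most \<open>card X\<close>, below the threshold, while
  \<open>x\<close> lifts the count of \<open>S\<close> above \<open>card X\<close>.\<close>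

lemma tcard_eq_exchange:
  assumes eq: "tcard K S = tcard K S'"
    and X: "finite X" "card X < K" "x \<in> S" "x \<notin> X" "X \<subseteq> S"
    and Y: "finite Y" "card Y \<le> card X"
  shows "\<exists>y\<in>S'. y \<notin> Y"
proof (rule ccontr)
  assume "\<not> ?thesis"
  then have "S' \<subseteq> Y" by auto
  then have "finite S'" "card S' \<le> card X"
    using Y finite_subset card_mono[of Y S'] by auto
  then have "tcard K S' \<le> card X" by (simp add: tcard_def)
  moreover have "card X < card S" if "finite S"
    using that X psubset_card_mono[of S X] by blast
  then have "card X < tcard K S" using X(2) by (simp add: tcard_def)
  ultimately show False using eq by simp
qed

section \<open>Trees of finite height\<close>

abbreviation children :: "'a rel \<Rightarrow> 'a \<Rightarrow> 'a set" where
  "children r x \<equiv> {y. immediate_pred r x y}"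

abbreviation depth :: "'a rel \<Rightarrow> 'a \<Rightarrow> nat" where
  "depth r x \<equiv> card (underS r x)"

definition down_closed :: "'a rel \<Rightarrow> 'a set \<Rightarrow> bool" where
  "down_closed r A \<longleftrightarrow> (\<forall>y\<in>A. \<forall>x. (x, y) \<in> r \<longrightarrow> x \<in> A)"

locale bounded_tree =
  fixes T :: "'a set" and r :: "'a rel" and root :: 'a and h :: nat
  assumes partial_order: "partial_order_on T r"
    and root: "root \<in> T" "\<And>x. x \<in> T \<Longrightarrow> (root, x) \<in> r"
    and fin: "\<And>x. x \<in> T \<Longrightarrow> finite (underS r x)"
    and chain: "\<And>x. x \<in> T \<Longrightarrow> total_on (underS r x) r"
    and height: "\<And>x. x \<in> T \<Longrightarrow> depth r x \<le> h"
begin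

lemma r_subset: "r \<subseteq> T \<times> T"
  using partial_order by (auto simp: partial_order_on_def preorder_on_def)

lemma r_refl: "x \<in> T \<Longrightarrow> (x, x) \<in> r"
  using partial_order by (auto simp: partial_order_on_def preorder_on_def refl_on_def)

lemma r_trans: "(x, y) \<in> r \<Longrightarrow> (y, z) \<in> r \<Longrightarrow> (x, z) \<in> r"
  using partial_order by (auto simp: partial_order_on_def preorder_on_def elim: transE)

lemma r_antisym: "(x, y) \<in> r \<Longrightarrow> (y, x) \<in> r \<Longrightarrow> x = y"
  using partial_order by (auto simp: partial_order_on_def elim: antisymD)

lemma child_in:
  assumes "immediate_pred r x y"
  shows "x \<in> T" "y \<in> T" "(x, y) \<in> r" "x \<noteq> y"
  using assms r_subset by (auto simp: immediate_pred_def underS_def)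

text \<open>Elements strictly below \<open>y\<close> are comparable, and one strictly above
  \<open>x\<close> would separate \<open>x\<close> from \<open>y\<close>. Hence what lies below a
  new child is determined by its parent.\<close>

lemma below_child_iff:
  assumes "immediate_pred r x y"
  shows "(z, y) \<in> r \<longleftrightarrow> z = y \<or> (z, x) \<in> r"
proof
  assume zy: "(z, y) \<in> r"
  show "z = y \<or> (z, x) \<in> r"
  proof (cases "z = y")
    case False
    then have z: "z \<in> underS r y" using zy by (simp add: underS_def)
    have x: "x \<in> underS r y" using assms by (simp add: immediate_pred_def)
    consider "z = x" | "(z, x) \<in> r" | "(x, z) \<in> r" "x \<noteq> z"
      using chain[OF child_in(2)[OF assms]] x z by (auto simp: total_on_def)
    then show ?thesis
    proof cases
      case 3
      then have "x \<in> underS r z" by (simp add: underS_def)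
      then show ?thesis using assms z unfolding immediate_pred_def by blast
    qed (use r_refl child_in(1)[OF assms] in auto)
  qed simp
qed (use child_in[OF assms] r_refl r_trans in blast)

lemma depth_child:
  assumes "immediate_pred r x y"
  shows "depth r y = Suc (depth r x)"
proof -
  have "underS r y = insert x (underS r x)"
    using below_child_iff[OF assms] child_in[OF assms] r_refl r_antisym
    by (auto simp: underS_def)
  then show ?thesis using fin[OF child_in(1)[OF assms]] by (simp add: underS_def)
qed

lemma depth_less:
  assumes "x \<in> underS r y" "y \<in> T"
  shows "depth r x < depth r y"
proof (rule psubset_card_mono)
  show "finite (underS r y)" using assms fin by blast
  show "underS r x \<subset> underS r y"
    using assms r_trans r_antisym by (auto simp: underS_def)
qed

lemma parent_exists:
  assumes "y \<in> T" "y \<noteq> root"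
  obtains x where "immediate_pred r x y"
proof -
  have "finite (underS r y)" "root \<in> underS r y"
    using assms fin root by (auto simp: underS_def)
  \<comment> \<open>The parent is an element of greatest depth in the finite chain strictly below
    \<open>y\<close>.\<close>
  then have "Max (depth r ` underS r y) \<in> depth r ` underS r y"
    by (intro Max_in) auto
  then obtain x where x: "x \<in> underS r y" "depth r x = Max (depth r ` underS r y)" by auto
  have "x \<notin> underS r z" if "z \<in> underS r y" for z
  proof
    assume "x \<in> underS r z"
    moreover have "z \<in> T" using that r_subset by (auto simp: underS_def)
    ultimately have "depth r x < depth r z" by (rule depth_less)
    moreover have "depth r z \<le> depth r x"
      using x(2) that \<open>finite (underS r y)\<close> by simp
    ultimately show False by simp
  qed
  then have "immediate_pred r x y" using x(1) by (auto simp: immediate_pred_def)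
  then show thesis by (rule that)
qed

lemma down_closed_T: "down_closed r T"
  using r_subset by (auto simp: down_closed_def)

lemma below_root: "(x, root) \<in> r \<Longrightarrow> x = root"
  using r_antisym r_subset root by blast

section \<open>Colourings\<close>

text \<open>The colour at stage \<open>j\<close> is the class of the nodes that agree on the truncated numbers of
  children in every class of the previous stage.\<close>

primrec colour :: "nat \<Rightarrow> nat \<Rightarrow> 'a \<Rightarrow> 'a set" where
  "colour K 0 x = T"
| "colour K (Suc j) x = {y \<in> T. \<forall>D\<in>colour K j ` T.
     tcard K (children r x \<inter> D) = tcard K (children r y \<inter> D)}"

lemma colour_self: "x \<in> T \<Longrightarrow> x \<in> colour K j x"
  by (cases j) auto

text \<open>Each stage partitions \<open>T\<close>: at a successor stage, lying in the class of
  \<open>x\<close> means having the same truncated counts as \<open>x\<close>; stage 0 has a single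
  class.\<close>

lemma colour_eq_iff: "x \<in> T \<Longrightarrow> y \<in> T \<Longrightarrow> colour K j y = colour K j x \<longleftrightarrow> y \<in> colour K j x"
proof
  assume "x \<in> T" "y \<in> T" "y \<in> colour K j x"
  then show "colour K j y = colour K j x" by (cases j) auto
qed (use colour_self in blast)

lemma finite_colours: "finite (colour K j ` T)"
proof (induction j)
  case (Suc j)
  let ?C = "colour K j ` T"
  \<comment> \<open>A class is recovered by \<open>?F\<close> from its vector of counts;
    \<open>restrict\<close> places that vector in a finite space of extensional functions.\<close>
  let ?v = "\<lambda>x. restrict (\<lambda>D. tcard K (children r x \<inter> D)) ?C"
  let ?F = "\<lambda>v. {y \<in> T. \<forall>D\<in>?C. v D = tcard K (children r y \<inter> D)}"
  have "colour K (Suc j) ` T \<subseteq> ?F ` (?C \<rightarrow>\<^sub>E {..K})"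
  proof
    fix c assume "c \<in> colour K (Suc j) ` T"
    then obtain x where "c = colour K (Suc j) x" by blast
    then have "c = ?F (?v x)" by simp
    moreover have "?v x \<in> ?C \<rightarrow>\<^sub>E {..K}" by (auto simp: tcard_le)
    ultimately show "c \<in> ?F ` (?C \<rightarrow>\<^sub>E {..K})" by blast
  qed
  moreover have "finite (?F ` (?C \<rightarrow>\<^sub>E {..K}))"
    by (rule finite_imageI, rule finite_PiE[OF Suc]) simp
  ultimately show ?case by (rule finite_subset)
next
  case 0
  have "colour K 0 ` T \<subseteq> {T}" by auto
  then show ?case by (rule finite_subset) simp
qed

text \<open>The stage is the number of levels that may still follow the node, so it drops by one
  from parent to child. Recording the depth ensures that nodes of equal colour are classified at the
  same stage.\<close>

definition node_colour :: "nat \<Rightarrow> 'a \<Rightarrow> nat \<times> 'a set" where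
  "node_colour K x = (depth r x, colour K (h - depth r x) x)"

abbreviation coloured_children :: "nat \<Rightarrow> 'a \<Rightarrow> nat \<times> 'a set \<Rightarrow> 'a set" where
  "coloured_children K x c \<equiv> {y \<in> children r x. node_colour K y = c}"

lemma finite_node_colours: "finite (node_colour K ` T)"
proof (rule finite_subset)
  show "node_colour K ` T \<subseteq> {..h} \<times> (\<Union>j\<le>h. colour K j ` T)"
    using height by (force simp: node_colour_def)
qed (use finite_colours in auto)

lemma node_colour_equitable:
  assumes "x \<in> T" "y \<in> T" and eq: "node_colour K x = node_colour K y"
  shows "tcard K (coloured_children K x c) = tcard K (coloured_children K y c)"
\<comment> \<open>A colour realised by a child of \<open>x\<close> or \<open>y\<close> names a class
  of the right stage; otherwise both counts are those of the empty set.\<close>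
proof (cases "coloured_children K x c = {} \<and> coloured_children K y c = {}")
  case False
  have deq: "depth r x = depth r y" using eq by (simp add: node_colour_def)
  from False obtain z where z: "immediate_pred r x z \<or> immediate_pred r y z" "node_colour K z = c"
    by auto
  have dz: "depth r z = Suc (depth r x)" and zT: "z \<in> T"
    using z(1) depth_child deq child_in(2) by auto
  define j where "j = h - depth r z"
  \<comment> \<open>The height bound at the child \<open>z\<close> keeps the natural subtraction
    from being cut off at 0, so the stage of the parent is a successor.\<close>
  have j: "h - depth r x = Suc j" using dz height[OF zT] by (simp add: j_def)
  have "node_colour K w = c \<longleftrightarrow> w \<in> colour K j z"
    if "immediate_pred r u w" "depth r u = depth r x" for u w
  proof -
    have "depth r w = depth r z" "w \<in> T" using that depth_child child_in dz by auto
    then show ?thesis using z(2) colour_eq_iff[OF zT] by (auto simp: node_colour_def j_def)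
  qed
  then have "coloured_children K x c = children r x \<inter> colour K j z"
    "coloured_children K y c = children r y \<inter> colour K j z"
    using deq by auto
  moreover have "y \<in> colour K (Suc j) x"
    using eq j deq colour_self[OF assms(2), of K "Suc j"] by (simp only: node_colour_def prod.inject)
  ultimately show ?thesis using zT by simp
next
  case True
  then show ?thesis by (simp only:)
qed

section \<open>Finite subtrees with the same colour counts\<close>

text \<open>Finitely many colours and a finite choice of children for each make the generated
  subtree finitely branching; bounded height then makes it finite.\<close>

lemma finite_equitable_subtree:
  obtains N where "finite N" "N \<subseteq> T" "root \<in> N" "down_closed r N"
    "\<And>x c. x \<in> N \<Longrightarrow> tcard K (coloured_children K x c \<inter> N) = tcard K (coloured_children K x c)"
proof -
  define f where "f x c = (SOME S0. S0 \<subseteq> coloured_children K x c \<and> finite S0 \<and>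
      tcard K S0 = tcard K (coloured_children K x c))" for x c
  have f: "f x c \<subseteq> coloured_children K x c" "finite (f x c)"
      "tcard K (f x c) = tcard K (coloured_children K x c)" for x c
    using someI_ex[OF tcard_finite_subset[of "coloured_children K x c" K]]
    by (simp_all only: f_def)
  \<comment> \<open>Only colours occurring in \<open>T\<close> are united, to keep the union finite;
    a nonempty \<open>f x c\<close> always has such a \<open>c\<close>.\<close>
  define sel where "sel x = (\<Union>c\<in>node_colour K ` T. f x c)" for x
  \<comment> \<open>\<open>L n\<close> is the level at depth \<open>n\<close> of the subtree
    generated from the root by \<open>sel\<close>.\<close>
  define L where "L n = ((\<lambda>A. \<Union>x\<in>A. sel x) ^^ n) {root}" for n
  have L0: "L 0 = {root}" and LS: "L (Suc n) = (\<Union>x\<in>L n. sel x)" for n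
    by (simp_all add: L_def)
  have sel_child: "sel x \<subseteq> children r x" for x
    using f(1) unfolding sel_def by blast
  have sub: "f x c \<subseteq> sel x" for x c
  proof
    fix y assume y: "y \<in> f x c"
    then have "y \<in> coloured_children K x c" using f(1) by blast
    then have "y \<in> T" "node_colour K y = c" using child_in(2)[of x y] by simp_all
    then show "y \<in> sel x" using y by (auto simp: sel_def)
  qed
  have finL: "finite (L n)" for n
  proof (induction n)
    case (Suc n)
    have "finite (sel x)" for x
      unfolding sel_def using f(2) finite_node_colours by (rule finite_UN_I[rotated])
    then show ?case using Suc LS by simp
  qed (simp add: L0)
  have depthL: "x \<in> T \<and> depth r x = n" if "x \<in> L n" for x n
    using that
  proof (induction n arbitrary: x)
    case 0
    then have "underS r x = {}" using L0 below_root by (auto simp: underS_def)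
    then show ?case using 0 L0 root by simp
  next
    case (Suc n)
    then obtain u where "u \<in> L n" "immediate_pred r u x" using LS sel_child by blast
    then show ?case using Suc.IH depth_child child_in(2) by simp
  qed
  have downL: "\<exists>m\<le>n. x \<in> L m" if "y \<in> L n" "(x, y) \<in> r" for x y n
    using that
  proof (induction n arbitrary: x y)
    case 0
    then show ?case using L0 below_root by auto
  next
    case (Suc n)
    then obtain u where u: "u \<in> L n" "immediate_pred r u y" using LS sel_child by blast
    then consider "x = y" | "(x, u) \<in> r" using Suc.prems below_child_iff by blast
    then show ?case
      by cases (use Suc u le_SucI in blast)+
  qed
  define N where "N = (\<Union>n\<le>h. L n)"
  have selN: "sel x \<subseteq> N" if "x \<in> N" for x
  proof
    fix y assume y: "y \<in> sel x"
    obtain n where "x \<in> L n" using \<open>x \<in> N\<close> by (auto simp: N_def)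
    then have "y \<in> L (Suc n)" using y LS by blast
    \<comment> \<open>Nodes of a level have its index as depth, so no level beyond \<open>h\<close>
      is inhabited and stopping at \<open>h\<close> loses nothing.\<close>
    moreover from this have "Suc n \<le> h" using depthL height by metis
    ultimately show "y \<in> N" unfolding N_def by blast
  qed
  show thesis
  proof (rule that)
    show "finite N" using finL by (simp add: N_def)
    show "N \<subseteq> T" using depthL by (auto simp: N_def)
    show "root \<in> N" using L0 by (auto simp: N_def)
    show "down_closed r N"
      unfolding down_closed_def
    proof (intro ballI allI impI)
      fix x y assume "y \<in> N" "(x, y) \<in> r"
      then obtain n where "n \<le> h" "y \<in> L n" unfolding N_def by blast
      then obtain m where "m \<le> n" "x \<in> L m" using downL \<open>(x, y) \<in> r\<close> by blast
      then show "x \<in> N" using \<open>n \<le> h\<close> unfolding N_def by auto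
    qed
    fix x c assume "x \<in> N"
    \<comment> \<open>The kept children lie between \<open>f x c\<close> and all children of colour
      \<open>c\<close>, whose truncated counts agree.\<close>
    then have "f x c \<subseteq> coloured_children K x c \<inter> N" using sub selN f(1) by blast
    then have "tcard K (coloured_children K x c) \<le> tcard K (coloured_children K x c \<inter> N)"
      using tcard_mono f(3) by metis
    then show "tcard K (coloured_children K x c \<inter> N) = tcard K (coloured_children K x c)"
      by (rule antisym[OF tcard_mono[OF Int_lower1]])
  qed
qed

section \<open>The back-and-forth argument\<close>

text \<open>Colours are always computed in the whole tree; only the counted children are cut down to
  \<open>U\<close> and \<open>V\<close>. Using two sets makes the notion symmetric, so one extension
  lemma serves both directions of the game.\<close>

definition equitable :: "nat \<Rightarrow> 'a set \<Rightarrow> 'a set \<Rightarrow> bool" where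
  "equitable K U V \<longleftrightarrow> (\<forall>x\<in>U. \<forall>y\<in>V. \<forall>c. node_colour K x = node_colour K y \<longrightarrow>
     tcard K (coloured_children K x c \<inter> U) = tcard K (coloured_children K y c \<inter> V))"

text \<open>By reflexivity and antisymmetry, preserving \<open>r\<close> in both directions already makes the relation
  \<open>p\<close> a bijection between its domain and its range.\<close>

definition position :: "nat \<Rightarrow> 'a set \<Rightarrow> 'a set \<Rightarrow> ('a \<times> 'a) set \<Rightarrow> bool" where
  "position K U V p \<longleftrightarrow> finite p \<and> p \<subseteq> U \<times> V \<and> (root, root) \<in> p \<and>
     down_closed r (Domain p) \<and> down_closed r (Range p) \<and>
     (\<forall>(x, y)\<in>p. node_colour K x = node_colour K y) \<and>
     (\<forall>(x, y)\<in>p. \<forall>(x', y')\<in>p. (x, x') \<in> r \<longleftrightarrow> (y, y') \<in> r)"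

lemma equitable_sym: "equitable K U V \<Longrightarrow> equitable K V U"
  by (simp add: equitable_def)

lemma position_converse: "position K U V p \<Longrightarrow> position K V U (p\<inverse>)"
  unfolding position_def by auto

lemma position_r_iff:
  assumes "position K U V p" "(x, y) \<in> p" "(x', y') \<in> p"
  shows "(x, x') \<in> r \<longleftrightarrow> (y, y') \<in> r"
  using assms unfolding position_def by blast

lemma position_eq_iff:
  assumes p: "position K U V p" "U \<subseteq> T" "V \<subseteq> T" and xy: "(x, y) \<in> p" "(x', y') \<in> p"
  shows "x = x' \<longleftrightarrow> y = y'"
proof -
  have "x \<in> T" "y \<in> T" using p xy unfolding position_def by auto
  then show ?thesis
    using position_r_iff[OF p(1) xy] position_r_iff[OF p(1) xy(2,1)] r_refl r_antisym by metis
qed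

text \<open>Being an immediate predecessor involves a quantifier over nodes. A node between
  \<open>y\<close> and \<open>y'\<close> lies in the range of \<open>p\<close> because the range is
  downward closed, and so can be pulled back between \<open>x\<close> and \<open>x'\<close>.\<close>

lemma position_immediate_pred:
  assumes p: "position K U V p" "U \<subseteq> T" "V \<subseteq> T" and xy: "(x, y) \<in> p" "(x', y') \<in> p"
    and pred: "immediate_pred r x x'"
  shows "immediate_pred r y y'"
  unfolding immediate_pred_def
proof (intro conjI notI)
  show "y \<in> underS r y'"
    using pred position_r_iff[OF p(1) xy] position_eq_iff[OF p xy]
    by (auto simp: immediate_pred_def underS_def)
  assume "\<exists>z. y \<in> underS r z \<and> z \<in> underS r y'"
  then obtain z where z: "y \<in> underS r z" "z \<in> underS r y'" by blast
  have "z \<in> Range p"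
    using p(1) xy(2) z(2) unfolding position_def down_closed_def underS_def by blast
  then obtain w where w: "(w, z) \<in> p" by blast
  have "x \<in> underS r w" "w \<in> underS r x'"
    using z position_r_iff[OF p(1) xy(1) w] position_eq_iff[OF p xy(1) w]
      position_r_iff[OF p(1) w xy(2)] position_eq_iff[OF p w xy(2)]
    by (auto simp: underS_def)
  then show False using pred by (auto simp: immediate_pred_def)
qed

lemma position_immediate_pred_iff:
  assumes "position K U V p" "U \<subseteq> T" "V \<subseteq> T" "(x, y) \<in> p" "(x', y') \<in> p"
  shows "immediate_pred r x x' \<longleftrightarrow> immediate_pred r y y'"
  using position_immediate_pred[OF assms]
    position_immediate_pred[OF position_converse[OF assms(1)] assms(3,2)] assms(4,5) by blast

lemma down_closed_insert_child:
  assumes "down_closed r A" "x \<in> A" "immediate_pred r x x'"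
  shows "down_closed r (insert x' A)"
  using assms below_child_iff[OF assms(3)] unfolding down_closed_def by blast

lemma position_extend_child:
  assumes p: "position K U V p" and UV: "U \<subseteq> T" "V \<subseteq> T" "equitable K U V"
    and "card p < K" and xy: "(x, y) \<in> p"
    and x': "immediate_pred r x x'" "x' \<in> U" "x' \<notin> Domain p"
  obtains y' where "position K U V (insert (x', y') p)"
proof -
  have finp: "finite p" using p by (simp add: position_def)
  define c where "c = node_colour K x'"
  let ?S = "coloured_children K x c \<inter> U" and ?S' = "coloured_children K y c \<inter> V"
  \<comment> \<open>\<open>q\<close> collects the pairs whose first component competes with
    \<open>x'\<close>: children of \<open>x\<close> of its colour. It is injective both ways, so
    equally many candidates are used on either side.\<close>
  define q where "q = {(a, b) \<in> p. a \<in> ?S}"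
  have q: "q \<subseteq> p" "finite q" using finp finite_subset[of q p] by (auto simp: q_def)
  have inj: "inj_on fst q" "inj_on snd q"
    using position_eq_iff[OF p UV(1,2)] q(1) unfolding inj_on_def by force+
  have "card q \<le> card p" using q finp card_mono by blast
  have "\<exists>y'\<in>?S'. y' \<notin> Range q"
  proof (rule tcard_eq_exchange)
    show "tcard K ?S = tcard K ?S'"
      using UV(3) p xy unfolding equitable_def position_def by blast
    show "card (Domain q) < K"
      using inj(1) \<open>card q \<le> card p\<close> \<open>card p < K\<close> by (simp add: Domain_fst card_image)
    show "card (Range q) \<le> card (Domain q)"
      using inj by (simp add: Domain_fst Range_snd card_image)
    show "x' \<in> ?S" using x' by (simp add: c_def)
    show "x' \<notin> Domain q" using x'(3) q(1) by blast
    show "Domain q \<subseteq> ?S" by (auto simp: q_def)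
  qed (use q in \<open>simp_all add: finite_Domain finite_Range\<close>)
  then obtain y' where y': "immediate_pred r y y'" "node_colour K y' = c" "y' \<in> V" "y' \<notin> Range q"
    by blast
  \<comment> \<open>Any used node that is a child of \<open>y\<close> of colour \<open>c\<close> is
    matched with a child of \<open>x\<close> of colour \<open>c\<close>, so avoiding the range of
    \<open>q\<close> is enough.\<close>
  have new: "y' \<notin> Range p"
  proof
    assume "y' \<in> Range p"
    then obtain a where a: "(a, y') \<in> p" by blast
    have "immediate_pred r x a" using position_immediate_pred_iff[OF p UV(1,2) xy a] y'(1) by simp
    moreover have "node_colour K a = c" "a \<in> U" using p a y'(2) unfolding position_def by auto
    ultimately have "(a, y') \<in> q" using a by (simp add: q_def)
    then show False using y'(4) by blast
  qed
  have downD: "down_closed r (Domain p)" and downR: "down_closed r (Range p)"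
    using p by (simp_all add: position_def)
  have old_new: "(a, x') \<in> r \<longleftrightarrow> (b, y') \<in> r" if ab: "(a, b) \<in> p" for a b
  proof -
    have "a \<noteq> x'" "b \<noteq> y'" using ab x'(3) new by auto
    then show ?thesis
      using below_child_iff[OF x'(1)] below_child_iff[OF y'(1)] position_r_iff[OF p ab xy] by blast
  qed
  \<comment> \<open>A new node below an old one would already belong to the downward closed domain
    or range.\<close>
  have new_old: "(x', a) \<notin> r" "(y', b) \<notin> r" if ab: "(a, b) \<in> p" for a b
    using ab downD downR x'(3) new unfolding down_closed_def by blast+
  have refl: "(x', x') \<in> r" "(y', y') \<in> r" using x' y' UV r_refl by auto
  have "position K U V (insert (x', y') p)"
    unfolding position_def
  proof (intro conjI)
    show "down_closed r (Domain (insert (x', y') p))"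
      using down_closed_insert_child[OF downD _ x'(1)] xy by auto
    show "down_closed r (Range (insert (x', y') p))"
      using down_closed_insert_child[OF downR _ y'(1)] xy by auto
    show "\<forall>(a, b)\<in>insert (x', y') p. \<forall>(a', b')\<in>insert (x', y') p. (a, a') \<in> r \<longleftrightarrow> (b, b') \<in> r"
      using old_new new_old refl position_r_iff[OF p] by auto
  qed (use p x' y' c_def in \<open>auto simp: position_def\<close>)
  then show thesis by (rule that)
qed

text \<open>Induction along the path from the root: the parent is matched first, then one child is
  added. Each level costs at most one pair, so fewer than \<open>K\<close> pairs are present
  whenever a child is added.\<close>

lemma position_extend:
  assumes p: "position K U V p"
    and UV: "U \<subseteq> T" "V \<subseteq> T" "equitable K U V" "down_closed r U"
    and "x \<in> U" and "card p + depth r x \<le> K"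
  shows "\<exists>q. p \<subseteq> q \<and> position K U V q \<and> x \<in> Domain q \<and> card q \<le> card p + depth r x"
  using assms(6,7)
proof (induction "depth r x" arbitrary: x rule: less_induct)
  case less
  show ?case
  proof (cases "x \<in> Domain p")
    case True
    then show ?thesis using p by auto
  next
    case False
    then have "x \<noteq> root" using p by (auto simp: position_def)
    then obtain u where u: "immediate_pred r u x"
      using parent_exists less.prems(1) UV(1) by blast
    have "u \<in> U" using child_in(3)[OF u] less.prems(1) UV(4) by (auto simp: down_closed_def)
    then obtain q where q: "p \<subseteq> q" "position K U V q" "u \<in> Domain q" "card q \<le> card p + depth r u"
      using less.hyps[of u] depth_child[OF u] less.prems(2) by auto
    show ?thesis
    proof (cases "x \<in> Domain q")
      case True
      then show ?thesis using q depth_child[OF u] by (intro exI[of _ q]) auto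
    next
      case False
      obtain v where v: "(u, v) \<in> q" using q(3) by blast
      have "card q < K" using q(4) depth_child[OF u] less.prems(2) by simp
      then obtain y where y: "position K U V (insert (x, y) q)"
        using position_extend_child[OF q(2) UV(1-3) _ v u less.prems(1) False] by blast
      have "card (insert (x, y) q) \<le> Suc (card q)" by (rule card_insert_le_m1) auto
      then show ?thesis
        using y q depth_child[OF u] by (intro exI[of _ "insert (x, y) q"]) auto
    qed
  qed
qed

text \<open>The relations \<open>rel\<close> are arbitrary apart from being preserved by positions,
  which lets the argument serve both languages. Each quantifier may consume up to \<open>h\<close>
  pairs of the budget \<open>K\<close>.\<close>

lemma sat_iff_position:
  assumes M: "\<And>R. interp M R = rel R \<inter> universe M \<times> universe M"
    and N: "\<And>R. interp N R = rel R \<inter> universe N \<times> universe N"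
    and UV: "universe M \<subseteq> T" "universe N \<subseteq> T" "down_closed r (universe M)"
      "down_closed r (universe N)" "equitable K (universe M) (universe N)"
    and inv: "\<And>p x y x' y' R. position K (universe M) (universe N) p \<Longrightarrow>
      (x, y) \<in> p \<Longrightarrow> (x', y') \<in> p \<Longrightarrow> (x, x') \<in> rel R \<longleftrightarrow> (y, y') \<in> rel R"
  shows "position K (universe M) (universe N) p \<Longrightarrow> (\<And>i. (e i, e' i) \<in> p) \<Longrightarrow>
    card p + qrank \<phi> * h \<le> K \<Longrightarrow> sat M e \<phi> \<longleftrightarrow> sat N e' \<phi>"
proof (induction \<phi> arbitrary: p e e')
  case (Eq i j)
  then show ?case using position_eq_iff[OF Eq.prems(1) UV(1,2)] by simp
next
  case (Rel R i j)
  have "p \<subseteq> universe M \<times> universe N" using Rel.prems(1) by (simp add: position_def)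
  then have "e k \<in> universe M" "e' k \<in> universe N" for k using Rel.prems(2)[of k] by auto
  moreover have "(e i, e j) \<in> rel R \<longleftrightarrow> (e' i, e' j) \<in> rel R"
    by (rule inv[OF Rel.prems(1,2,2)])
  ultimately show ?case using M[of R] N[of R] by simp
next
  case (Neg \<phi>)
  then show ?case by simp
next
  case (Conj \<phi> \<psi>)
  have "qrank \<phi> * h \<le> qrank (Conj \<phi> \<psi>) * h" "qrank \<psi> * h \<le> qrank (Conj \<phi> \<psi>) * h"
    by (simp_all add: mult_le_mono1)
  then have "card p + qrank \<phi> * h \<le> K" "card p + qrank \<psi> * h \<le> K"
    using Conj.prems(3) by linarith+
  then show ?case
    using Conj.IH(1)[OF Conj.prems(1,2)] Conj.IH(2)[OF Conj.prems(1,2)] by simp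
next
  case (Exi i \<phi>)
  have step: "sat M (e(i := a)) \<phi> \<longleftrightarrow> sat N (e'(i := b)) \<phi>"
    if "p \<subseteq> q" "position K (universe M) (universe N) q" "(a, b) \<in> q" "card q \<le> card p + h"
    for q a b
    by (rule Exi.IH[OF that(2)]) (use that Exi.prems in auto)
  show ?case
  proof
    assume "sat M e (Exi i \<phi>)"
    then obtain a where a: "a \<in> universe M" "sat M (e(i := a)) \<phi>" by auto
    have d: "depth r a \<le> h" using a UV height by blast
    then obtain q where q: "p \<subseteq> q" "position K (universe M) (universe N) q" "a \<in> Domain q"
        "card q \<le> card p + depth r a"
      using position_extend[OF Exi.prems(1) UV(1,2,5,3) a(1)] Exi.prems(3) by auto
    then obtain b where b: "(a, b) \<in> q" by blast
    then have "b \<in> universe N" using q(2) by (auto simp: position_def)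
    then show "sat N e' (Exi i \<phi>)" using step[OF q(1,2) b] q(4) d a(2) by auto
  next
    assume "sat N e' (Exi i \<phi>)"
    then obtain b where b: "b \<in> universe N" "sat N (e'(i := b)) \<phi>" by auto
    have d: "depth r b \<le> h" using b UV height by blast
    \<comment> \<open>A move in the second structure is answered in the converse position, and the
      result is turned around again.\<close>
    then obtain q' where q': "p\<inverse> \<subseteq> q'" "position K (universe N) (universe M) q'" "b \<in> Domain q'"
        "card q' \<le> card (p\<inverse>) + depth r b"
      using position_extend[OF position_converse[OF Exi.prems(1)] UV(2,1)
          equitable_sym[OF UV(5)] UV(4) b(1)] Exi.prems(3) by auto
    define q where "q = q'\<inverse>"
    have q: "p \<subseteq> q" "position K (universe M) (universe N) q" "card q \<le> card p + h"
      using q' position_converse d by (auto simp: q_def)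
    obtain a where a: "(a, b) \<in> q" using q'(3) by (auto simp: q_def)
    then have "a \<in> universe M" using q(2) by (auto simp: position_def)
    then show "sat M e (Exi i \<phi>)" using step[OF q(1,2) a q(3)] b(2) by auto
  qed
qed

section \<open>From the game to pseudofiniteness\<close>

lemma pseudofiniteI:
  assumes M: "universe M = T" "\<And>R. interp M R \<subseteq> T \<times> T"
    and inv: "\<And>K U V p x y x' y' R. position K U V p \<Longrightarrow> U \<subseteq> T \<Longrightarrow> V \<subseteq> T \<Longrightarrow>
      (x, y) \<in> p \<Longrightarrow> (x', y') \<in> p \<Longrightarrow> (x, x') \<in> interp M R \<longleftrightarrow> (y, y') \<in> interp M R"
  shows "pseudofinite M"
  unfolding pseudofinite_def
proof (intro allI impI)
  fix \<phi> :: "'b fm" assume \<phi>: "sentence \<phi>" "models M \<phi>"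
  \<comment> \<open>The successor pays for the pair of roots with which the game starts.\<close>
  define K where "K = Suc (qrank \<phi> * h)"
  obtain A where A: "finite A" "A \<subseteq> T" "root \<in> A" "down_closed r A"
    "\<And>x c. x \<in> A \<Longrightarrow> tcard K (coloured_children K x c \<inter> A) = tcard K (coloured_children K x c)"
    by (rule finite_equitable_subtree[of K]) blast
  define N where "N = \<lparr>universe = A, interp = (\<lambda>R. interp M R \<inter> A \<times> A)\<rparr>"
  have N: "universe N = A" "\<And>R. interp N R = interp M R \<inter> A \<times> A" by (simp_all add: N_def)
  \<comment> \<open>Equal colours give equal counts inside \<open>T\<close>, and passing to
    \<open>A\<close> preserves the counts at each of its nodes.\<close>
  have eq: "equitable K T A"
    unfolding equitable_def
  proof (intro ballI allI impI)
    fix x y c assume xy: "x \<in> T" "y \<in> A" "node_colour K x = node_colour K y"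
    have "coloured_children K x c \<inter> T = coloured_children K x c"
      using child_in(2) by blast
    then show "tcard K (coloured_children K x c \<inter> T) = tcard K (coloured_children K y c \<inter> A)"
      using A(5)[OF xy(2), of c]
        node_colour_equitable[OF xy(1) subsetD[OF A(2) xy(2)] xy(3), of c] by (simp only:)
  qed
  have pos: "position K T A {(root, root)}"
    using A(3) root below_root by (auto simp: position_def down_closed_def)
  have "sat M (\<lambda>_. root) \<phi> \<longleftrightarrow> sat N (\<lambda>_. root) \<phi>"
  proof (rule sat_iff_position[where rel = "interp M" and p = "{(root, root)}" and K = K])
    show "interp M R = interp M R \<inter> universe M \<times> universe M" for R
      using M(1) M(2)[of R] by (simp add: Int_absorb2)
    show "(x, x') \<in> interp M R \<longleftrightarrow> (y, y') \<in> interp M R"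
      if "position K (universe M) (universe N) p" "(x, y) \<in> p" "(x', y') \<in> p" for p x y x' y' R
      using inv[OF that(1) _ _ that(2,3)] M(1) N(1) A(2) by simp
  qed (use M N A down_closed_T eq pos in \<open>simp_all add: K_def\<close>)
  moreover have "sat M (\<lambda>_. root) \<phi>" using \<phi>(2) M root by (auto simp: models_def)
  ultimately have "models N \<phi>"
    using models_sentence_iff[OF \<phi>(1), of "\<lambda>_. root" N] A(3) N by auto
  moreover have "is_struc N" using A(3) N by (auto simp: is_struc_def)
  ultimately show "has_finite_model \<phi>" using has_finite_modelI \<phi>(1) A(1) N(1) by metis
qed

lemma pseudofinite_le_struc: "pseudofinite (le_struc T r)"
proof (rule pseudofiniteI)
  have r: "interp (le_struc T r) R = r" for R by (cases R) (simp add: le_struc_def)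
  show "interp (le_struc T r) R \<subseteq> T \<times> T" for R using r r_subset by simp
  show "(x, x') \<in> interp (le_struc T r) R \<longleftrightarrow> (y, y') \<in> interp (le_struc T r) R"
    if "position K U V p" "(x, y) \<in> p" "(x', y') \<in> p" for K U V p x y x' y' R
    using position_r_iff[OF that] r by simp
qed (simp add: le_struc_def)

lemma pseudofinite_pred_struc: "pseudofinite (pred_struc T r)"
proof (rule pseudofiniteI)
  have pred: "interp (pred_struc T r) R = {(x, y). immediate_pred r x y}" for R
    by (cases R) (simp add: pred_struc_def)
  show "interp (pred_struc T r) R \<subseteq> T \<times> T" for R using pred child_in by auto
  show "(x, x') \<in> interp (pred_struc T r) R \<longleftrightarrow> (y, y') \<in> interp (pred_struc T r) R"
    if "position K U V p" "U \<subseteq> T" "V \<subseteq> T" "(x, y) \<in> p" "(x', y') \<in> p" for K U V p x y x' y' R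
    using position_immediate_pred_iff[OF that] pred by simp
qed (simp add: pred_struc_def)

end

theorem theorem5p12:
  fixes T :: "'a set" and r :: "'a rel"
  assumes "is_tree T r" and "finite_height T r"
  shows "pseudofinite (pred_struc T r) \<and> pseudofinite (le_struc T r)"
proof -
  obtain root where "root \<in> T" "\<forall>x\<in>T. (root, x) \<in> r"
    using assms(1) by (auto simp: is_tree_def)
  moreover obtain h where "\<forall>x\<in>T. card (underS r x) \<le> h"
    using assms(2) by (auto simp: finite_height_def)
  ultimately have "bounded_tree T r root h"
    using assms(1) by unfold_locales (auto simp: is_tree_def)
  then show ?thesis
    by (intro conjI bounded_tree.pseudofinite_pred_struc bounded_tree.pseudofinite_le_struc)
qed

end
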